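(* Let $\mathfrak g=\mathfrak{sl}_{n+1}$ and let $\mathfrak n=\mathfrak n_{\mathcal T}$ be a nilradical with $\mathcal K(\mathfrak n)=\{\beta_1,\dots,\beta_k\}$ (so that $\mathcal T\cap\{\alpha_k,\alpha_{n+1-k}\}\ne\varnothing$). (a) If both $\alpha_k\in\mathcal T$ and $\alpha_{n+1-k}\in\mathcal T$, then $\mathcal F(\mathfrak n)=\mathfrak n_{\{\alpha_k\}}\cap\mathfrak n_{\{\alpha_{n+1-k}\}}$, the north-east square of size $k$ in $\mathfrak{sl}_{n+1}$; in particular $\dim\mathcal F(\mathfrak n)=k^2$. (b) If exactly one simple root $\alpha\in\{\alpha_k,\alpha_{n+1-k}\}$ belongs to $\mathcal T$ (with $\alpha_k\ne\alpha_{n+1-k}$), then $\mathcal F(\mathfrak n)=\mathfrak n_{\{\alpha\}}$; in particular $\dim\mathcal F(\mathfrak n)=k(n+1-k)$.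
   Context: Everything is over $\mathbb C$. For $\mathfrak g=\mathfrak{sl}_{n+1}$, the fixed Borel subalgebra is the set of upper-triangular traceless matrices, $\Delta^+=\{\varepsilon_i-\varepsilon_j\mid i<j\}$, with simple roots $\Pi=\{\alpha_1,\dots,\alpha_n\}$, $\alpha_i=\varepsilon_i-\varepsilon_{i+1}$; $\mathfrak g_\gamma$ is the root space of $\gamma$ and $[\gamma:\alpha]$ the coefficient of $\alpha\in\Pi$ in $\gamma$. For nonempty $\mathcal T\subset\Pi$, $\mathfrak n_{\mathcal T}=\bigoplus\mathfrak g_\gamma$, the sum over all $\gamma\in\Delta^+$ with $[\gamma:\alpha]>0$ for some $\alpha\in\mathcal T$; these are the nonzero nilradicals of standard parabolic subalgebras. $\Delta(\mathfrak n)$ is the set of roots of $\mathfrak n$. The Kostant cascade of $\mathfrak{sl}_{n+1}$ is $\mathcal K=\{\beta_1,\dots,\beta_t\}$, $t=[(n+1)/2]$, $\beta_i=\varepsilon_i-\varepsilon_{n+2-i}=\alpha_i+\dots+\alpha_{n+1-i}$. Put $\mathcal K(\mathfrak n)=\mathcal K\cap\Delta(\mathfrak n)$; it is always of the form $\{\beta_1,\dots,\beta_k\}$ with $1\le k\le t$. For a Lie algebra $\mathfrak q$, $\mathfrak q^*_{\rm reg}$ is the set of $\xi\in\mathfrak q^*$ whose stabiliser $\mathfrak q^\xi$ has minimal dimension; the Frobenius semiradical is $\mathcal F(\mathfrak q)=\sum_{\xi\in\mathfrak q^*_{\rm reg}}\mathfrak q^\xi$. *)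

theory Defs
  imports "HOL-Analysis.Analysis"
begin

locale lie_algebra = vector_space scale
  for scale :: "'k::field \<Rightarrow> 'v::ab_group_add \<Rightarrow> 'v" +
  fixes bracket :: "'v \<Rightarrow> 'v \<Rightarrow> 'v"
  assumes bracket_add_left: "bracket (x + y) z = bracket x z + bracket y z"
    and bracket_add_right: "bracket x (y + z) = bracket x y + bracket x z"
    and bracket_scale_left: "bracket (scale c x) y = scale c (bracket x y)"
    and bracket_scale_right: "bracket x (scale c y) = scale c (bracket x y)"
    and bracket_self: "bracket x x = 0"
    and jacobi: "bracket x (bracket y z) + bracket y (bracket z x) + bracket z (bracket x y) = 0"
begin

text \<open>Below, \<open>q\<close> is a Lie subalgebra of the ambient Lie algebra, given by its underlying set.\<close>

definition dual_space :: "'v set \<Rightarrow> ('v \<Rightarrow> 'k) set" where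
  "dual_space q = {\<xi> \<in> extensional q.
     (\<forall>x\<in>q. \<forall>y\<in>q. \<xi> (x + y) = \<xi> x + \<xi> y) \<and> (\<forall>c. \<forall>x\<in>q. \<xi> (scale c x) = c * \<xi> x)}"

text \<open>The stabiliser for the coadjoint action, which is \<open>(x \<cdot> \<xi>) y = - \<xi> [x, y]\<close>.\<close>

definition stabiliser :: "'v set \<Rightarrow> ('v \<Rightarrow> 'k) \<Rightarrow> 'v set" where
  "stabiliser q \<xi> = {x \<in> q. \<forall>y\<in>q. \<xi> (bracket x y) = 0}"

definition regular_functionals :: "'v set \<Rightarrow> ('v \<Rightarrow> 'k) set" where
  "regular_functionals q =
     {\<xi> \<in> dual_space q. \<forall>\<eta>\<in>dual_space q. dim (stabiliser q \<xi>) \<le> dim (stabiliser q \<eta>)}"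

definition frobenius_semiradical :: "'v set \<Rightarrow> 'v set" where
  "frobenius_semiradical q = span (\<Union>\<xi>\<in>regular_functionals q. stabiliser q \<xi>)"

end

type_synonym 'm cmat = "complex^'m^'m"
type_synonym 'm weight = "real^'m"

definition mat_scale :: "complex \<Rightarrow> 'm::finite cmat \<Rightarrow> 'm cmat" where
  "mat_scale c A = (\<chi> i j. c * A $ i $ j)"

definition commutator :: "'m cmat \<Rightarrow> 'm cmat \<Rightarrow> 'm::finite cmat" where
  "commutator A B = A ** B - B ** A"

lemma mat_scale_mult_left: "mat_scale c A ** B = mat_scale c (A ** B)"
  by (simp add: mat_scale_def matrix_matrix_mult_def vec_eq_iff sum_distrib_left mult.assoc)

lemma mat_scale_mult_right: "A ** mat_scale c B = mat_scale c (A ** B)"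
  by (simp add: mat_scale_def matrix_matrix_mult_def vec_eq_iff sum_distrib_left mult.left_commute)

lemma mat_scale_diff: "mat_scale c (A - B) = mat_scale c A - mat_scale c B"
  by (simp add: mat_scale_def vec_eq_iff algebra_simps)

lemma matrix_mult_diff_left: "(A - B) ** C = A ** C - B ** (C :: 'm::finite cmat)"
  by (simp add: matrix_matrix_mult_def vec_eq_iff algebra_simps sum_subtractf)

lemma matrix_mult_diff_right: "C ** (A - B) = C ** A - (C :: 'm::finite cmat) ** B"
  by (simp add: matrix_matrix_mult_def vec_eq_iff algebra_simps sum_subtractf)

lemma matrix_mult_add_left: "(A + B) ** C = A ** C + B ** (C :: 'm::finite cmat)"
  by (simp add: matrix_matrix_mult_def vec_eq_iff algebra_simps sum.distrib)

global_interpretation gl: lie_algebra mat_scale "commutator :: 'm cmat \<Rightarrow> _ \<Rightarrow> 'm::finite cmat"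
proof unfold_locales
  fix a b :: complex and x y z :: "'m cmat"
  show "mat_scale a (x + y) = mat_scale a x + mat_scale a y"
    and "mat_scale (a + b) x = mat_scale a x + mat_scale b x"
    and "mat_scale a (mat_scale b x) = mat_scale (a * b) x"
    and "mat_scale 1 x = x"
    by (simp_all add: mat_scale_def vec_eq_iff algebra_simps)
  show "commutator (x + y) z = commutator x z + commutator y z"
    and "commutator x (y + z) = commutator x y + commutator x z"
    by (simp_all add: commutator_def matrix_add_ldistrib matrix_mult_add_left)
  show "commutator (mat_scale a x) y = mat_scale a (commutator x y)"
    and "commutator x (mat_scale a y) = mat_scale a (commutator x y)"
    by (simp_all add: commutator_def mat_scale_mult_left mat_scale_mult_right mat_scale_diff)
  show "commutator x x = 0"
    by (simp add: commutator_def)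
  show "commutator x (commutator y z) + commutator y (commutator z x)
      + commutator z (commutator x y) = 0"
    by (simp add: commutator_def matrix_mult_diff_left matrix_mult_diff_right matrix_mul_assoc)
qed

text \<open>The rows and columns of the matrices are indexed by a finite linear order \<open>'m\<close> with
  \<open>n + 1\<close> elements; \<open>idx i\<close> is its \<open>i\<close>-th smallest element, for \<open>1 \<le> i \<le> CARD('m)\<close>.\<close>

definition idx :: "nat \<Rightarrow> 'm::{finite,linorder}" where
  "idx i = sorted_list_of_set UNIV ! (i - 1)"

definition sl :: "('m::finite cmat) set" where
  "sl = {A. trace A = 0}"

definition cartan :: "('m::finite cmat) set" where
  "cartan = {A \<in> sl. \<forall>i j. i \<noteq> j \<longrightarrow> A $ i $ j = 0}"

text \<open>Roots are vectors in \<open>\<real>\<^sup>n\<^sup>+\<^sup>1\<close> with standard basis \<open>\<epsilon>\<^sub>1, \<dots>, \<epsilon>\<^sub>n\<^sub>+\<^sub>1\<close>; such a vector acts on the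
  Cartan subalgebra by \<open>\<epsilon>\<^sub>i(H) = H\<^sub>i\<^sub>i\<close>. All roots lie in the sum-zero hyperplane, on which
  passing to functionals on the traceless diagonal matrices is injective.\<close>

definition eps :: "nat \<Rightarrow> 'm::{finite,linorder} weight" where
  "eps i = axis (idx i) 1"

definition weight_eval :: "'m weight \<Rightarrow> 'm::finite cmat \<Rightarrow> complex" where
  "weight_eval \<gamma> H = (\<Sum>i\<in>UNIV. complex_of_real (\<gamma> $ i) * H $ i $ i)"

definition root_space :: "'m weight \<Rightarrow> ('m::finite cmat) set" where
  "root_space \<gamma> = {X \<in> sl. \<forall>H\<in>cartan. commutator H X = mat_scale (weight_eval \<gamma> H) X}"

definition positive_roots :: "('m::{finite,linorder} weight) set" where
  "positive_roots = {eps i - eps j | i j. 1 \<le> i \<and> i < j \<and> j \<le> CARD('m)}"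

definition simple_root :: "nat \<Rightarrow> 'm::{finite,linorder} weight" where
  "simple_root i = eps i - eps (i + 1)"

definition simple_roots :: "('m::{finite,linorder} weight) set" where
  "simple_roots = simple_root ` {1..<CARD('m)}"

definition root_coeff :: "'m::{finite,linorder} weight \<Rightarrow> 'm weight \<Rightarrow> real" where
  "root_coeff \<gamma> \<alpha> = representation simple_roots \<gamma> \<alpha>"

definition nilradical_roots :: "('m::{finite,linorder} weight) set \<Rightarrow> ('m weight) set" where
  "nilradical_roots T = {\<gamma> \<in> positive_roots. \<exists>\<alpha>\<in>T. root_coeff \<gamma> \<alpha> > 0}"

definition nilradical :: "('m::{finite,linorder} weight) set \<Rightarrow> ('m cmat) set" where
  "nilradical T = gl.span (\<Union>\<gamma>\<in>nilradical_roots T. root_space \<gamma>)"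

definition cascade_root :: "nat \<Rightarrow> 'm::{finite,linorder} weight" where
  "cascade_root i = eps i - eps (CARD('m) + 1 - i)"

definition kostant_cascade :: "('m::{finite,linorder} weight) set" where
  "kostant_cascade = cascade_root ` {1..CARD('m) div 2}"

definition north_east_square :: "nat \<Rightarrow> ('m::{finite,linorder} cmat) set" where
  "north_east_square k = {A. \<forall>i\<in>{1..CARD('m)}. \<forall>j\<in>{1..CARD('m)}.
     A $ idx i $ idx j \<noteq> 0 \<longrightarrow> i \<le> k \<and> CARD('m) - k < j}"

end

theory Submission
  imports Defs
begin

text \<open>For \<open>c\<close> in \<open>{k, n + 1 - k}\<close> with \<open>\<alpha>\<^sub>c\<close> in \<open>T\<close>, the nilradical of \<open>{\<alpha>\<^sub>c}\<close> (rows up to \<open>c\<close>, columns beyond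
  \<open>c\<close>) is abelian, and with respect to the sum \<open>\<xi>\<close> of the first \<open>k\<close> antidiagonal entries it is its own
  orthogonal complement in \<open>n\<^sub>T\<close>. Comparing the two kernels of the pairing of \<open>n\<^sub>T\<close> with such an ideal
  \<open>a\<close>, every stabiliser meets \<open>a\<close> in dimension at least \<open>2 dim a - dim n\<^sub>T\<close>, and that of \<open>\<xi>\<close> has exactly
  this dimension. So \<open>\<xi>\<close> is regular and every regular stabiliser lies in \<open>a\<close>. Conversely, the
  intersection of the available ideals is a north-east corner; its south-west elementary matrix
  stabilises \<open>\<xi>\<close>, and conjugating it by upper unipotent matrices, which preserves the semiradical,
  produces the whole corner.\<close>

subsection \<open>Commutative polarisations\<close>

context finite_dimensional_vector_space
begin

text \<open>Any \<open>w0\<close> in \<open>W\<close> with \<open>f w0\<close> nonzero spans a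
  complement of the kernel in \<open>W\<close>. Linearity is asked for on \<open>W\<close> only,
  since elements of \<open>dual_space q\<close> are linear just on \<open>q\<close>.\<close>

lemma dim_le_dim_kernel_Suc:
  fixes f :: "'b \<Rightarrow> 'a"
  assumes W: "subspace W"
    and add: "\<And>x y. x \<in> W \<Longrightarrow> y \<in> W \<Longrightarrow> f (x + y) = f x + f y"
    and scl: "\<And>c x. x \<in> W \<Longrightarrow> f (scale c x) = c * f x"
  shows "dim W \<le> dim {w \<in> W. f w = 0} + 1"
proof (cases "\<forall>w\<in>W. f w = 0")
  case True
  then have "{w \<in> W. f w = 0} = W"
    by blast
  then show ?thesis
    by simp
next
  case False
  then obtain w0 where w0: "w0 \<in> W" "f w0 \<noteq> 0"
    by blast
  let ?K = "{w \<in> W. f w = 0}"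
  have "w \<in> span (insert w0 ?K)" if w: "w \<in> W" for w
  proof -
    define c where "c = - (f w / f w0)"
    have cw: "scale c w0 \<in> W"
      using w0(1) W by (simp add: subspace_scale)
    have "w + scale c w0 \<in> ?K"
      using w0(2) subspace_add[OF W w cw] add[OF w cw] scl[OF w0(1), of c]
      by (simp add: c_def del: scale_minus_left)
    then have "w + scale c w0 \<in> span (insert w0 ?K)"
      by (intro span_base) simp
    moreover have "scale c w0 \<in> span (insert w0 ?K)"
      by (intro span_scale span_base) simp
    ultimately have "(w + scale c w0) - scale c w0 \<in> span (insert w0 ?K)"
      by (rule span_diff)
    then show ?thesis
      by simp
  qed
  then have "dim W \<le> dim (insert w0 ?K)"
    by (intro dim_mono) blast
  then show ?thesis
    by (simp add: dim_insert split: if_splits)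
qed

lemma dim_le_dim_common_kernel_plus_card:
  fixes f :: "'c \<Rightarrow> 'b \<Rightarrow> 'a"
  assumes "finite C" and W: "subspace W"
    and add: "\<And>c x y. c \<in> C \<Longrightarrow> x \<in> W \<Longrightarrow> y \<in> W \<Longrightarrow> f c (x + y) = f c x + f c y"
    and scl: "\<And>c r x. c \<in> C \<Longrightarrow> x \<in> W \<Longrightarrow> f c (scale r x) = r * f c x"
  shows "dim W \<le> dim {w \<in> W. \<forall>c\<in>C. f c w = 0} + card C"
  using \<open>finite C\<close> add scl
proof (induction C rule: finite_induct)
  case empty
  then show ?case by simp
next
  case (insert c C)
  let ?W = "{w \<in> W. \<forall>c\<in>C. f c w = 0}"
  have zero: "f d 0 = 0" if "d \<in> insert c C" for d
    using insert.prems(2)[OF that subspace_0[OF W], of 0] by simp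
  have sub: "subspace ?W"
    using W zero insert.prems by (simp add: subspace_def)
  have "dim ?W \<le> dim {w \<in> ?W. f c w = 0} + 1"
    by (rule dim_le_dim_kernel_Suc[OF sub]) (auto simp: insert.prems)
  also have "{w \<in> ?W. f c w = 0} = {w \<in> W. \<forall>c\<in>insert c C. f c w = 0}"
    by auto
  finally have "dim ?W \<le> dim {w \<in> W. \<forall>c\<in>insert c C. f c w = 0} + 1" .
  moreover have "dim W \<le> dim ?W + card C"
    by (rule insert.IH) (auto simp: insert.prems)
  ultimately show ?case
    using insert.hyps by simp
qed

text \<open>Extend a basis \<open>D\<close> of the left kernel to a basis \<open>E\<close> of
  \<open>U\<close>. Vectors of \<open>D\<close> impose no condition on \<open>W\<close>, so the
  right kernel is cut out of \<open>W\<close> by the \<open>card (E - D)\<close> equations coming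
  from the rest of \<open>E\<close>.\<close>

lemma dim_plus_left_kernel_le:
  fixes B :: "'b \<Rightarrow> 'b \<Rightarrow> 'a"
  assumes U: "subspace U" and W: "subspace W"
    and addl: "\<And>x y w. x \<in> U \<Longrightarrow> y \<in> U \<Longrightarrow> w \<in> W \<Longrightarrow> B (x + y) w = B x w + B y w"
    and scll: "\<And>c x w. x \<in> U \<Longrightarrow> w \<in> W \<Longrightarrow> B (scale c x) w = c * B x w"
    and addr: "\<And>x v w. x \<in> U \<Longrightarrow> v \<in> W \<Longrightarrow> w \<in> W \<Longrightarrow> B x (v + w) = B x v + B x w"
    and sclr: "\<And>c x w. x \<in> U \<Longrightarrow> w \<in> W \<Longrightarrow> B x (scale c w) = c * B x w"
  shows "dim W + dim {x \<in> U. \<forall>w\<in>W. B x w = 0} \<le> dim {w \<in> W. \<forall>x\<in>U. B x w = 0} + dim U"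
proof -
  let ?L = "{x \<in> U. \<forall>w\<in>W. B x w = 0}" and ?R = "{w \<in> W. \<forall>x\<in>U. B x w = 0}"
  have zero: "B 0 w = 0" if "w \<in> W" for w
    using scll[OF subspace_0[OF U] that, of 0] by simp
  have L: "subspace ?L"
    by (rule subspaceI) (auto simp: zero addl scll subspace_0 subspace_add subspace_scale U)
  obtain D where D: "finite D" "D \<subseteq> ?L" "independent D" "span D = ?L" "card D = dim ?L"
    by (rule basis_subspace_exists[OF L])
  have "D \<subseteq> U"
    using D(2) by blast
  then obtain E where E: "D \<subseteq> E" "E \<subseteq> U" "independent E" "U \<subseteq> span E"
    by (rule maximal_independent_subset_extend[OF _ D(3)])
  have finE: "finite E" and cardE: "card E = dim U"
    using finiteI_independent[OF E(3)] basis_card_eq_dim[OF E(2,4,3)] by simp_all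
  have "{w \<in> W. \<forall>x\<in>E - D. B x w = 0} \<subseteq> ?R"
  proof safe
    fix w x assume w: "w \<in> W" "\<forall>x\<in>E - D. B x w = 0" and x: "x \<in> U"
    let ?K = "{x \<in> U. B x w = 0}"
    have "subspace ?K"
      by (rule subspaceI)
        (auto simp: zero addl scll w(1) subspace_0 subspace_add subspace_scale U)
    moreover have "E \<subseteq> ?K"
      using w D(2) E(2) by auto
    ultimately have "span E \<subseteq> ?K"
      by (rule span_minimal[rotated])
    then show "B x w = 0"
      using E(4) x by auto
  qed
  then have "dim {w \<in> W. \<forall>x\<in>E - D. B x w = 0} \<le> dim ?R"
    by (rule dim_subset)
  moreover have "dim W \<le> dim {w \<in> W. \<forall>x\<in>E - D. B x w = 0} + card (E - D)"
    using finE E(2) addr sclr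
    by (intro dim_le_dim_common_kernel_plus_card[where f = B] W) auto
  moreover have "card (E - D) + card D = card E"
    using D(1) E(1) finE by (simp add: card_Diff_subset card_mono)
  ultimately show ?thesis
    using D(5) cardE by linarith
qed

text \<open>Row rank equals column rank: the codimensions of the two kernels agree. The one-sided
  bound is applied to the pairing and to its transpose.\<close>

lemma dim_plus_left_kernel:
  fixes B :: "'b \<Rightarrow> 'b \<Rightarrow> 'a"
  assumes U: "subspace U" and W: "subspace W"
    and addl: "\<And>x y w. x \<in> U \<Longrightarrow> y \<in> U \<Longrightarrow> w \<in> W \<Longrightarrow> B (x + y) w = B x w + B y w"
    and scll: "\<And>c x w. x \<in> U \<Longrightarrow> w \<in> W \<Longrightarrow> B (scale c x) w = c * B x w"
    and addr: "\<And>x v w. x \<in> U \<Longrightarrow> v \<in> W \<Longrightarrow> w \<in> W \<Longrightarrow> B x (v + w) = B x v + B x w"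
    and sclr: "\<And>c x w. x \<in> U \<Longrightarrow> w \<in> W \<Longrightarrow> B x (scale c w) = c * B x w"
  shows "dim W + dim {x \<in> U. \<forall>w\<in>W. B x w = 0} = dim {w \<in> W. \<forall>x\<in>U. B x w = 0} + dim U"
proof (rule antisym)
  show "dim W + dim {x \<in> U. \<forall>w\<in>W. B x w = 0} \<le> dim {w \<in> W. \<forall>x\<in>U. B x w = 0} + dim U"
    by (rule dim_plus_left_kernel_le[where B = B, OF U W]) (simp_all only: assms)
  have "dim U + dim {w \<in> W. \<forall>x\<in>U. B x w = 0} \<le> dim {x \<in> U. \<forall>w\<in>W. B x w = 0} + dim W"
    by (rule dim_plus_left_kernel_le[where B = "\<lambda>w x. B x w", OF W U]) (simp_all only: assms)
  then show "dim {w \<in> W. \<forall>x\<in>U. B x w = 0} + dim U \<le> dim W + dim {x \<in> U. \<forall>w\<in>W. B x w = 0}"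
    by simp
qed

end

section \<open>Stabilisers, abelian subspaces and automorphisms of a finite-dimensional Lie
  algebra\<close>

locale fd_lie_algebra = lie_algebra scale bracket + finite_dimensional_vector_space scale Basis
  for scale :: "'k::field \<Rightarrow> 'v::ab_group_add \<Rightarrow> 'v" and bracket and Basis
begin

lemma bracket_skew: "bracket y x = - bracket x y"
proof -
  have "bracket x x + bracket x y + (bracket y x + bracket y y) = 0"
    using bracket_self[of "x + y"] by (simp only: bracket_add_left bracket_add_right ac_simps)
  then have "bracket y x + bracket x y = 0"
    by (simp add: bracket_self add.commute)
  then show ?thesis
    by (simp add: eq_neg_iff_add_eq_0)
qed

context
  fixes q :: "'v set"
  assumes q: "subspace q" and q_closed: "\<And>x y. x \<in> q \<Longrightarrow> y \<in> q \<Longrightarrow> bracket x y \<in> q"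
begin

lemma bracket_zero_left: "bracket 0 y = 0"
  using bracket_scale_left[of 0 0 y] by simp

lemma dual_space_add: "\<xi> \<in> dual_space q \<Longrightarrow> x \<in> q \<Longrightarrow> y \<in> q \<Longrightarrow> \<xi> (x + y) = \<xi> x + \<xi> y"
  and dual_space_scale: "\<xi> \<in> dual_space q \<Longrightarrow> x \<in> q \<Longrightarrow> \<xi> (scale c x) = c * \<xi> x"
  by (auto simp: dual_space_def)

lemma dual_space_zero: "\<xi> \<in> dual_space q \<Longrightarrow> \<xi> 0 = 0"
  using dual_space_scale[of \<xi> 0 0] q by (simp add: subspace_0)

lemma dual_space_minus: "\<xi> \<in> dual_space q \<Longrightarrow> x \<in> q \<Longrightarrow> \<xi> (- x) = - \<xi> x"
  using dual_space_scale[of \<xi> x "-1"] by simp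

lemma subspace_stabiliser: "\<xi> \<in> dual_space q \<Longrightarrow> subspace (stabiliser q \<xi>)"
  unfolding stabiliser_def using q q_closed
  by (simp add: subspace_def bracket_add_left bracket_scale_left bracket_zero_left
      dual_space_add dual_space_scale dual_space_zero)

text \<open>Pair \<open>q\<close> with \<open>a\<close> by \<xi> of the bracket. The kernel in
  \<open>q\<close> is the orthogonal complement of \<open>a\<close>; by skew symmetry the kernel in
  \<open>a\<close> is the part of the stabiliser lying in \<open>a\<close>.\<close>

lemma dim_abelian_plus_orthogonal:
  assumes a: "subspace a" "a \<subseteq> q" and abel: "\<And>x y. x \<in> a \<Longrightarrow> y \<in> a \<Longrightarrow> bracket x y = 0"
    and \<xi>: "\<xi> \<in> dual_space q"
  shows "dim a + dim {x \<in> q. \<forall>y\<in>a. \<xi> (bracket x y) = 0} = dim (stabiliser q \<xi> \<inter> a) + dim q"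
proof -
  have "dim a + dim {x \<in> q. \<forall>y\<in>a. \<xi> (bracket x y) = 0}
      = dim {y \<in> a. \<forall>x\<in>q. \<xi> (bracket x y) = 0} + dim q"
    by (rule dim_plus_left_kernel)
      (use a \<xi> q q_closed in \<open>auto simp: bracket_add_left bracket_add_right bracket_scale_left
        bracket_scale_right dual_space_add dual_space_scale subset_iff\<close>)
  moreover have "\<xi> (bracket x y) = 0 \<longleftrightarrow> \<xi> (bracket y x) = 0" if "x \<in> q" "y \<in> q" for x y
    using dual_space_minus[OF \<xi> q_closed[OF that]] by (simp add: bracket_skew[of y x])
  then have "{y \<in> a. \<forall>x\<in>q. \<xi> (bracket x y) = 0} = stabiliser q \<xi> \<inter> a"
    using a by (auto simp: stabiliser_def)
  ultimately show ?thesis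
    by simp
qed

text \<open>For the alternating form \<xi>([x, y]) the abelian subspace \<open>a\<close> is
  isotropic, and \<open>orth\<close> makes it maximal isotropic, so \<open>a\<close> is a
  commutative polarisation at \<xi>. A single such \<xi> bounds the stabilisers of all regular
  functionals.\<close>

lemma commutative_polarisation:
  assumes a: "subspace a" "a \<subseteq> q" and abel: "\<And>x y. x \<in> a \<Longrightarrow> y \<in> a \<Longrightarrow> bracket x y = 0"
    and \<xi>: "\<xi> \<in> dual_space q"
    and orth: "{x \<in> q. \<forall>y\<in>a. \<xi> (bracket x y) = 0} \<subseteq> a"
  shows "\<xi> \<in> regular_functionals q" and "frobenius_semiradical q \<subseteq> a"
proof -
  have self_orth: "a \<subseteq> {x \<in> q. \<forall>y\<in>a. \<eta> (bracket x y) = 0}" if "\<eta> \<in> dual_space q" for \<eta>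
    using a abel dual_space_zero[OF that] by auto
  have stab: "stabiliser q \<xi> \<subseteq> a"
    using a orth by (auto simp: stabiliser_def)
  then have "stabiliser q \<xi> \<inter> a = stabiliser q \<xi>"
    by blast
  moreover have "{x \<in> q. \<forall>y\<in>a. \<xi> (bracket x y) = 0} = a"
    using orth self_orth[OF \<xi>] by (rule subset_antisym)
  ultimately have "dim a + dim a = dim (stabiliser q \<xi>) + dim q"
    using dim_abelian_plus_orthogonal[OF a abel \<xi>] by simp
  \<comment> \<open>The left side is 2 dim a - dim q. For \<eta> the orthogonal complement of
    \<open>a\<close> still contains \<open>a\<close>, so the same count yields at least this number
    on the right.\<close>
  then have le: "dim (stabiliser q \<xi>) \<le> dim (stabiliser q \<eta> \<inter> a)" if "\<eta> \<in> dual_space q" for \<eta>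
    using dim_abelian_plus_orthogonal[OF a abel that] dim_subset[OF self_orth[OF that]]
    by linarith
  show "\<xi> \<in> regular_functionals q"
    using \<xi> le order_trans[OF le dim_subset[OF Int_lower1]] by (simp add: regular_functionals_def)
  have "stabiliser q \<eta> \<subseteq> a" if "\<eta> \<in> regular_functionals q" for \<eta>
  proof -
    have \<eta>: "\<eta> \<in> dual_space q" and "dim (stabiliser q \<eta>) \<le> dim (stabiliser q \<xi>)"
      using that \<xi> by (auto simp: regular_functionals_def)
    then have "dim (stabiliser q \<eta>) \<le> dim (stabiliser q \<eta> \<inter> a)"
      using le[OF \<eta>] by linarith
    then have "stabiliser q \<eta> \<inter> a = stabiliser q \<eta>"
      by (intro subspace_dim_equal subspace_inter subspace_stabiliser \<eta> a(1)) auto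
    then show ?thesis
      by blast
  qed
  then show "frobenius_semiradical q \<subseteq> a"
    unfolding frobenius_semiradical_def by (intro span_minimal a(1)) blast
qed

text \<open>An automorphism permutes the regular functionals: pulling \<xi> back along the inverse
  \<open>g\<close> moves its stabiliser by \<open>f\<close>. The homomorphism property is therefore
  stated for \<open>g\<close>.\<close>

lemma frobenius_semiradical_automorphism:
  assumes f: "Vector_Spaces.linear scale scale f" and g: "Vector_Spaces.linear scale scale g"
    and fq: "\<And>x. x \<in> q \<Longrightarrow> f x \<in> q" and gq: "\<And>x. x \<in> q \<Longrightarrow> g x \<in> q"
    and fg: "\<And>x. f (g x) = x" and gf: "\<And>x. g (f x) = x"
    and hom: "\<And>x y. g (bracket x y) = bracket (g x) (g y)"
    and x: "x \<in> frobenius_semiradical q"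
  shows "f x \<in> frobenius_semiradical q"
proof -
  interpret f: Vector_Spaces.linear scale scale f by (rule f)
  interpret g: Vector_Spaces.linear scale scale g by (rule g)
  have "f y \<in> (\<Union>\<xi>\<in>regular_functionals q. stabiliser q \<xi>)"
    if \<xi>: "\<xi> \<in> regular_functionals q" and y: "y \<in> stabiliser q \<xi>" for \<xi> y
  proof -
    \<comment> \<open>The restriction keeps the pulled-back functional extensional, as membership in
      \<open>dual_space\<close> demands.\<close>
    define \<eta> where "\<eta> = restrict (\<lambda>z. \<xi> (g z)) q"
    have \<xi>D: "\<xi> \<in> dual_space q"
      using \<xi> by (simp add: regular_functionals_def)
    have \<eta>D: "\<eta> \<in> dual_space q"
      using q gq by (simp add: dual_space_def \<eta>_def g.add g.scale dual_space_add[OF \<xi>D]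
        dual_space_scale[OF \<xi>D] subspace_add subspace_scale)
    have val: "\<eta> (bracket u v) = \<xi> (bracket (g u) (g v))" if "u \<in> q" "v \<in> q" for u v
      using q_closed that by (simp add: \<eta>_def hom)
    have "stabiliser q \<eta> = f ` stabiliser q \<xi>"
    proof safe
      fix u assume u: "u \<in> stabiliser q \<eta>"
      then have uq: "u \<in> q" by (simp add: stabiliser_def)
      have "\<xi> (bracket (g u) v) = 0" if "v \<in> q" for v
        using u val[OF uq fq[OF that]] fq[OF that] by (simp add: stabiliser_def gf)
      then have "g u \<in> stabiliser q \<xi>"
        using gq[OF uq] by (simp add: stabiliser_def)
      then show "u \<in> f ` stabiliser q \<xi>"
        using fg[of u] by force
    next
      fix u assume "u \<in> stabiliser q \<xi>"
      then show "f u \<in> stabiliser q \<eta>"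
        using fq gq val by (simp add: stabiliser_def gf)
    qed
    \<comment> \<open>An upper bound is enough, because the stabiliser of \<xi> already has minimal
      dimension.\<close>
    moreover have "dim (f ` S) \<le> dim S" for S
    proof -
      obtain B where B: "B \<subseteq> S" "independent B" "S \<subseteq> span B" "card B = dim S"
        by (rule basis_exists)
      have "f ` S \<subseteq> span (f ` B)"
        using B(3) by (auto simp: f.span_image)
      then have "dim (f ` S) \<le> card (f ` B)"
        using B(2) finiteI_independent by (intro dim_le_card) auto
      also have "\<dots> \<le> card B"
        using B(2) finiteI_independent by (intro card_image_le) auto
      finally show ?thesis using B(4) by simp
    qed
    ultimately have "dim (stabiliser q \<eta>) \<le> dim (stabiliser q \<xi>)"
      by simp
    then have "\<eta> \<in> regular_functionals q"
      using \<xi> \<eta>D unfolding regular_functionals_def by (blast intro: order_trans)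
    moreover have "f y \<in> stabiliser q \<eta>"
      using y \<open>stabiliser q \<eta> = f ` stabiliser q \<xi>\<close> by simp
    ultimately show ?thesis
      by blast
  qed
  then have "f ` (\<Union>\<xi>\<in>regular_functionals q. stabiliser q \<xi>)
      \<subseteq> (\<Union>\<xi>\<in>regular_functionals q. stabiliser q \<xi>)"
    by blast
  then have "f ` span (\<Union>\<xi>\<in>regular_functionals q. stabiliser q \<xi>)
      \<subseteq> span (\<Union>\<xi>\<in>regular_functionals q. stabiliser q \<xi>)"
    by (simp add: f.span_image[symmetric] span_mono)
  then show ?thesis
    using x by (auto simp: frobenius_semiradical_def)
qed

end

end

subsection \<open>Matrices with prescribed support\<close>

definition elem :: "'m \<Rightarrow> 'm \<Rightarrow> 'm::finite cmat" where
  "elem a b = (\<chi> i j. if i = a \<and> j = b then 1 else 0)"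

lemma elem_nth [simp]: "elem a b $ i $ j = (if i = a \<and> j = b then 1 else 0)"
  by (simp add: elem_def)

text \<open>Nilradicals, their abelian ideals and the corners all have this shape, which reduces
  inclusions, intersections and dimensions to statements about sets of positions.\<close>

definition supported :: "('m \<times> 'm) set \<Rightarrow> ('m::finite cmat) set" where
  "supported S = {A. \<forall>i j. A $ i $ j \<noteq> 0 \<longrightarrow> (i, j) \<in> S}"

lemma supported_zero: "A \<in> supported S \<Longrightarrow> (i, j) \<notin> S \<Longrightarrow> A $ i $ j = 0"
  by (auto simp: supported_def)

lemma elem_in_supported [simp]: "elem a b \<in> supported S \<longleftrightarrow> (a, b) \<in> S"
  by (auto simp: supported_def)

lemma supported_mono: "S \<subseteq> S' \<Longrightarrow> supported S \<subseteq> supported S'"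
  by (auto simp: supported_def)

lemma supported_Int: "supported S \<inter> supported S' = supported (S \<inter> S')"
  by (auto simp: supported_def)

lemma mat_scale_nth [simp]: "mat_scale c A $ i $ j = c * A $ i $ j"
  by (simp add: mat_scale_def)

lemma subspace_supported: "gl.subspace (supported S)"
proof (rule gl.subspaceI)
  fix x y :: "'a cmat" assume "x \<in> supported S" "y \<in> supported S"
  then have "x $ i $ j + y $ i $ j = 0" if "(i, j) \<notin> S" for i j
    using that by (simp add: supported_zero)
  then show "x + y \<in> supported S"
    unfolding supported_def by auto
qed (auto simp: supported_def)

lemma supported_sum_elem:
  assumes "A \<in> supported S"
  shows "A = (\<Sum>p\<in>S. mat_scale (A $ fst p $ snd p) (elem (fst p) (snd p)))"
proof -
  have "A $ i $ j = (\<Sum>p\<in>S. mat_scale (A $ fst p $ snd p) (elem (fst p) (snd p))) $ i $ j" for i j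
  proof -
    have "(\<Sum>p\<in>S. mat_scale (A $ fst p $ snd p) (elem (fst p) (snd p))) $ i $ j
        = (\<Sum>p\<in>S. A $ fst p $ snd p * (if i = fst p \<and> j = snd p then 1 else 0))"
      by (simp only: sum_component mat_scale_nth elem_nth)
    also have "\<dots> = (\<Sum>p\<in>S. if p = (i, j) then A $ i $ j else 0)"
      by (rule sum.cong) (auto simp: prod_eq_iff)
    also have "\<dots> = A $ i $ j"
      using assms by (simp add: supported_zero)
    finally show ?thesis
      by (rule sym)
  qed
  then show ?thesis
    unfolding vec_eq_iff by blast
qed

lemma span_elem: "gl.span ((\<lambda>(a, b). elem a b) ` S) = supported S"
proof
  show "gl.span ((\<lambda>(a, b). elem a b) ` S) \<subseteq> supported S"
    by (rule gl.span_minimal[OF _ subspace_supported]) auto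
  show "supported S \<subseteq> gl.span ((\<lambda>(a, b). elem a b) ` S)"
  proof
    fix A assume "A \<in> supported S"
    then have "A = (\<Sum>p\<in>S. mat_scale (A $ fst p $ snd p) (elem (fst p) (snd p)))"
      by (rule supported_sum_elem)
    also have "\<dots> \<in> gl.span ((\<lambda>(a, b). elem a b) ` S)"
      by (intro gl.span_sum gl.span_scale gl.span_base) (auto split: prod.splits)
    finally show "A \<in> gl.span ((\<lambda>(a, b). elem a b) ` S)" .
  qed
qed

lemma elem_eq_iff [simp]: "elem a b = elem c d \<longleftrightarrow> a = c \<and> b = d"
proof
  assume "elem a b = elem c d"
  then have "elem a b $ a $ b = elem c d $ a $ b"
    by simp
  then show "a = c \<and> b = d"
    by (simp split: if_splits)
qed simp

lemma independent_elem: "gl.independent ((\<lambda>(a, b). elem a b) ` S)"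
  unfolding gl.dependent_def
proof (safe)
  fix a b
  assume "elem a b \<in> gl.span ((\<lambda>(a, b). elem a b) ` S - {elem a b})"
  also have "(\<lambda>(a, b). elem a b) ` S - {elem a b} = (\<lambda>(a, b). elem a b) ` (S - {(a, b)})"
    by auto
  finally show False
    by (simp add: span_elem)
qed

lemma dim_supported: "gl.dim (supported S) = card S"
proof -
  have "gl.dim (supported S) = card ((\<lambda>(a, b). elem a b) ` S)"
    by (simp add: span_elem[symmetric] gl.dim_span_eq_card_independent[OF independent_elem]
        del: gl.dim_span)
  also have "\<dots> = card S"
    by (rule card_image) (auto simp: inj_on_def)
  finally show ?thesis .
qed

text \<open>The matrix units form a complex basis, so \<open>gl.dim\<close> is the complex
  dimension, in contrast to the real vector space structure that the matrix type carries.\<close>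

global_interpretation gl: fd_lie_algebra mat_scale
  "commutator :: 'm cmat \<Rightarrow> _ \<Rightarrow> 'm::finite cmat" "(\<lambda>(a, b). elem a b) ` UNIV"
proof unfold_locales
  show "gl.span ((\<lambda>(a, b). elem a b) ` UNIV) = (UNIV :: 'm cmat set)"
    by (simp add: span_elem supported_def)
qed (use independent_elem in simp_all)

subsection \<open>Roots and nilradicals\<close>

definition pos :: "'m::{finite,linorder} \<Rightarrow> nat" where
  "pos = inv_into {1..CARD('m)} idx"

lemma bij_betw_idx: "bij_betw idx {1..CARD('m)} (UNIV :: 'm::{finite,linorder} set)"
proof -
  have "bij_betw ((!) (sorted_list_of_set UNIV)) {..<CARD('m)} (UNIV :: 'm set)"
    by (rule bij_betw_nth) auto
  moreover have "bij_betw (\<lambda>i. i - 1) {1..CARD('m)} {..<CARD('m)}"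
    by (rule bij_betwI[where g = Suc]) auto
  ultimately have "bij_betw ((!) (sorted_list_of_set UNIV) \<circ> (\<lambda>i. i - 1)) {1..CARD('m)} (UNIV :: 'm set)"
    by (rule bij_betw_trans[rotated])
  then show ?thesis
    by (simp add: idx_def[abs_def] comp_def)
qed

lemma pos_idx [simp]: "1 \<le> i \<Longrightarrow> i \<le> CARD('m) \<Longrightarrow> pos (idx i :: 'm::{finite,linorder}) = i"
  unfolding pos_def by (rule bij_betw_inv_into_left[OF bij_betw_idx]) simp

lemma idx_pos [simp]: "idx (pos a) = a"
  unfolding pos_def by (rule bij_betw_inv_into_right[OF bij_betw_idx]) simp

lemma pos_bounds: "1 \<le> pos a" "pos (a :: 'm::{finite,linorder}) \<le> CARD('m)"
proof -
  have "pos a \<in> {1..CARD('m)}"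
    unfolding pos_def using bij_betw_idx by (intro inv_into_into) (auto simp: bij_betw_def)
  then show "1 \<le> pos a" "pos a \<le> CARD('m)"
    by auto
qed

lemma pos_eq_iff [simp]: "pos a = pos b \<longleftrightarrow> a = b"
  by (metis idx_pos)

lemma card_pos_Collect: "card {a :: 'm::{finite,linorder}. P (pos a)} = card {i \<in> {1..CARD('m)}. P i}"
proof (rule bij_betw_same_card)
  show "bij_betw pos {a :: 'm. P (pos a)} {i \<in> {1..CARD('m)}. P i}"
    by (rule bij_betwI[where g = idx]) (use pos_bounds in auto)
qed

text \<open>On weights with coordinate sum zero this is the \<open>j\<close>-th fundamental
  coweight: it is dual to the simple roots and so reads off their coefficients.\<close>

definition partial_sum :: "nat \<Rightarrow> 'm::{finite,linorder} weight \<Rightarrow> real" where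
  "partial_sum j v = (\<Sum>a | pos a \<le> j. v $ a)"

lemma linear_partial_sum: "linear (partial_sum j)"
  by (rule linearI) (simp_all add: partial_sum_def sum.distrib sum_distrib_left)

lemma partial_sum_eps:
  assumes "1 \<le> i" "i \<le> CARD('m)"
  shows "partial_sum j (eps i :: 'm::{finite,linorder} weight) = (if i \<le> j then 1 else 0)"
  using assms by (simp add: partial_sum_def eps_def axis_def if_distrib sum.delta cong: if_cong)

lemma partial_sum_simple_root:
  assumes "i \<in> {1..<CARD('m)}"
  shows "partial_sum j (simple_root i :: 'm::{finite,linorder} weight) = (if i = j then 1 else 0)"
  using assms by (auto simp: simple_root_def linear_diff[OF linear_partial_sum] partial_sum_eps)

lemma inj_on_simple_root: "inj_on (simple_root :: nat \<Rightarrow> 'm::{finite,linorder} weight) {1..<CARD('m)}"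
proof (rule inj_onI)
  fix i j assume ij: "i \<in> {1..<CARD('m)}" "j \<in> {1..<CARD('m)}"
    and "simple_root i = (simple_root j :: 'm weight)"
  then have "partial_sum i (simple_root i :: 'm weight) = partial_sum i (simple_root j :: 'm weight)"
    by simp
  then show "i = j"
    by (simp only: partial_sum_simple_root[OF ij(1)] partial_sum_simple_root[OF ij(2)])
      (simp split: if_splits)
qed

lemma independent_simple_roots: "independent (simple_roots :: 'm::{finite,linorder} weight set)"
  unfolding dependent_def
proof safe
  fix v :: "'m weight"
  assume v: "v \<in> simple_roots" "v \<in> span (simple_roots - {v})"
  then obtain i where i: "i \<in> {1..<CARD('m)}" "v = simple_root i"
    by (auto simp: simple_roots_def)
  have "span (simple_roots - {v}) \<subseteq> {w. partial_sum i w = 0}"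
  proof (rule span_minimal)
    show "subspace {w. partial_sum i w = 0}"
      by (rule linear_subspace_kernel[OF linear_partial_sum])
    show "simple_roots - {v} \<subseteq> {w. partial_sum i w = 0}"
      using i by (auto simp: simple_roots_def partial_sum_simple_root)
  qed
  then have "partial_sum i v = 0"
    using v by auto
  then show False
    using partial_sum_simple_root[OF i(1), of i] i(2) by simp
qed

lemma eps_diff_eq_sum_simple_root:
  "a \<le> b \<Longrightarrow> eps a - eps b = (\<Sum>j = a..<b. simple_root j)"
  by (induction b rule: dec_induct) (simp_all add: simple_root_def algebra_simps)

text \<open>Applying \<open>partial_sum j\<close> to the expansion in simple roots isolates the
  \<open>j\<close>-th coefficient; applied to \<open>eps a - eps b\<close> directly it tests whether
  the cut after \<open>j\<close> falls between \<open>a\<close> and \<open>b\<close>.\<close>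

lemma root_coeff_positive_root:
  assumes "1 \<le> a" "a < b" "b \<le> CARD('m)" "j \<in> {1..<CARD('m)}"
  shows "root_coeff (eps a - eps b) (simple_root j :: 'm::{finite,linorder} weight)
    = (if a \<le> j \<and> j < b then 1 else 0)"
proof -
  let ?\<gamma> = "eps a - eps b :: 'm weight" and ?r = "representation (simple_roots :: 'm weight set)"
  have sp: "?\<gamma> \<in> span simple_roots"
    using assms unfolding eps_diff_eq_sum_simple_root[OF less_imp_le[OF assms(2)]]
    by (intro span_sum span_base) (auto simp: simple_roots_def)
  have fin: "finite (simple_roots :: 'm weight set)"
    by (simp add: simple_roots_def)
  have "?\<gamma> = (\<Sum>v\<in>simple_roots. ?r ?\<gamma> v *\<^sub>R v)"
    using sum_representation_eq[OF independent_simple_roots sp fin] by simp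
  then have "partial_sum j ?\<gamma> = (\<Sum>v\<in>simple_roots. ?r ?\<gamma> v * partial_sum j v)"
    using linear_sum[OF linear_partial_sum, of j "\<lambda>v. ?r ?\<gamma> v *\<^sub>R v" simple_roots]
    by (simp add: linear_cmul[OF linear_partial_sum])
  also have "\<dots> = (\<Sum>i\<in>{1..<CARD('m)}. ?r ?\<gamma> (simple_root i) * (if i = j then 1 else 0))"
    unfolding simple_roots_def sum.reindex[OF inj_on_simple_root] comp_apply
    by (intro sum.cong refl) (simp only: partial_sum_simple_root)
  also have "\<dots> = ?r ?\<gamma> (simple_root j)"
    using assms by (simp add: if_distrib sum.delta cong: if_cong)
  finally show ?thesis
    using assms by (auto simp: root_coeff_def linear_diff[OF linear_partial_sum] partial_sum_eps)
qed

text \<open>Cut the index range after every \<open>j\<close> in \<open>J\<close>: these are the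
  positions strictly above the resulting block diagonal. A single cut leaves one north-east
  block.\<close>

definition separated :: "nat set \<Rightarrow> ('m::{finite,linorder} \<times> 'm) set" where
  "separated J = {(a, b). \<exists>j\<in>J. pos a \<le> j \<and> j < pos b}"

definition simple_indices :: "'m::{finite,linorder} weight set \<Rightarrow> nat set" where
  "simple_indices T = {j \<in> {1..<CARD('m)}. simple_root j \<in> T}"

lemma positive_root_in_nilradical_roots:
  fixes T :: "'m::{finite,linorder} weight set"
  assumes "T \<subseteq> simple_roots" "1 \<le> a" "a < b" "b \<le> CARD('m)"
  shows "eps a - eps b \<in> nilradical_roots T \<longleftrightarrow> (\<exists>j\<in>simple_indices T. a \<le> j \<and> j < b)"
proof -
  have "eps a - eps b \<in> nilradical_roots T
      \<longleftrightarrow> (\<exists>\<alpha>\<in>simple_root ` simple_indices T. root_coeff (eps a - eps b) (\<alpha> :: 'm weight) > 0)"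
  proof -
    have "simple_root ` simple_indices T = T"
      using assms(1) by (auto simp: simple_roots_def simple_indices_def)
    moreover have "eps a - eps b \<in> (positive_roots :: 'm weight set)"
      using assms by (auto simp: positive_roots_def)
    ultimately show ?thesis
      by (simp only: nilradical_roots_def mem_Collect_eq simp_thms)
  qed
  also have "\<dots> \<longleftrightarrow> (\<exists>j\<in>simple_indices T. root_coeff (eps a - eps b) (simple_root j :: 'm weight) > 0)"
    by blast
  also have "\<dots> \<longleftrightarrow> (\<exists>j\<in>simple_indices T. a \<le> j \<and> j < b)"
    by (intro bex_cong refl) (simp add: root_coeff_positive_root[OF assms(2-4)] simple_indices_def)
  finally show ?thesis .
qed

section \<open>Root spaces as coordinate lines, and nilradicals as block matrices\<close>

lemma weight_eval_eps_diff: "weight_eval (eps i - eps j) H = H $ idx i $ idx i - H $ idx j $ idx j"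
proof -
  have "weight_eval (eps i - eps j) H
      = (\<Sum>a\<in>UNIV. (if a = idx i then H $ a $ a else 0) - (if a = idx j then H $ a $ a else 0))"
    unfolding weight_eval_def by (rule sum.cong) (auto simp: eps_def axis_def)
  then show ?thesis
    by (simp add: sum_subtractf sum.delta)
qed

lemma commutator_diagonal_nth:
  assumes "H \<in> cartan"
  shows "commutator H X $ i $ j = (H $ i $ i - H $ j $ j) * X $ i $ j"
proof -
  have H: "H $ a $ b = (if b = a then H $ a $ a else 0)" for a b
    using assms by (auto simp: cartan_def)
  have "(H ** X) $ i $ j = (\<Sum>b\<in>UNIV. if b = i then H $ i $ i * X $ b $ j else 0)"
    unfolding matrix_matrix_mult_def vec_lambda_beta by (intro sum.cong refl, subst H) simp
  moreover have "(X ** H) $ i $ j = (\<Sum>b\<in>UNIV. if b = j then X $ i $ b * H $ j $ j else 0)"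
    unfolding matrix_matrix_mult_def vec_lambda_beta by (intro sum.cong refl, subst H) auto
  ultimately show ?thesis
    by (simp add: commutator_def sum.delta algebra_simps)
qed

lemma root_space_positive_root:
  assumes "1 \<le> a" "a < b" "b \<le> CARD('m)"
  shows "root_space (eps a - eps b) = supported {(idx a, idx b :: 'm::{finite,linorder})}"
proof -
  have ne: "idx a \<noteq> (idx b :: 'm)"
  proof
    assume "idx a = (idx b :: 'm)"
    then have "pos (idx a :: 'm) = pos (idx b :: 'm)"
      by simp
    then show False
      using assms by simp
  qed
  show ?thesis
  proof safe
    fix X :: "'m cmat" assume X: "X \<in> root_space (eps a - eps b)"
    \<comment> \<open>This is the coroot, on which the root takes the value 2. At every other
      position the difference of diagonal entries of \<open>H\<close> is not 2, which forces the
      entry of \<open>X\<close> there to vanish.\<close>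
    define H :: "'m cmat" where "H = elem (idx a) (idx a) - elem (idx b) (idx b)"
    have "trace H = 0"
      using ne by (simp add: trace_def H_def sum_subtractf)
    then have H: "H \<in> cartan"
      by (simp add: cartan_def sl_def) (simp add: H_def)
    have "commutator H X = mat_scale 2 X"
      using X H ne by (simp add: root_space_def weight_eval_eps_diff) (simp add: H_def)
    then have "(H $ i $ i - H $ j $ j) * X $ i $ j = 2 * X $ i $ j" for i j
      using commutator_diagonal_nth[OF H, of X i j] by simp
    then have "X $ i $ j = 0 \<or> H $ i $ i - H $ j $ j = 2" for i j
      using mult_right_cancel by blast
    moreover have "i = idx a \<and> j = idx b" if "H $ i $ i - H $ j $ j = 2" for i j
      using that ne by (simp add: H_def split: if_splits)
    ultimately show "X \<in> supported {(idx a, idx b)}"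
      by (auto simp: supported_def)
  next
    fix X :: "'m cmat" assume X: "X \<in> supported {(idx a, idx b)}"
    have "X $ i $ i = 0" for i
      using X ne by (intro supported_zero[of X "{(idx a, idx b)}"]) auto
    then have "X \<in> sl"
      by (simp add: sl_def trace_def)
    moreover have "commutator H X = mat_scale (weight_eval (eps a - eps b) H) X" if "H \<in> cartan" for H
      using X by (auto simp: vec_eq_iff commutator_diagonal_nth[OF that] weight_eval_eps_diff supported_def)
    ultimately show "X \<in> root_space (eps a - eps b)"
      by (simp add: root_space_def)
  qed
qed

lemma nilradical_eq_supported:
  fixes T :: "'m::{finite,linorder} weight set"
  assumes T: "T \<subseteq> simple_roots"
  shows "nilradical T = supported (separated (simple_indices T))"
proof -
  have "(\<Union>\<gamma>\<in>nilradical_roots T. root_space \<gamma>) = (\<Union>p\<in>separated (simple_indices T). supported {p})"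
  proof (intro equalityI UN_least)
    fix \<gamma> assume g: "\<gamma> \<in> nilradical_roots T"
    then obtain a b where ab: "\<gamma> = eps a - eps b" "1 \<le> a" "a < b" "b \<le> CARD('m)"
      by (auto simp: nilradical_roots_def positive_roots_def)
    have "pos (idx a :: 'm) = a" "pos (idx b :: 'm) = b"
      using ab by simp_all
    moreover have "\<exists>j\<in>simple_indices T. a \<le> j \<and> j < b"
      using g positive_root_in_nilradical_roots[OF T ab(2-4)] ab(1) by blast
    ultimately have "(idx a, idx b :: 'm) \<in> separated (simple_indices T)"
      by (simp only: separated_def mem_Collect_eq prod.case)
    then show "root_space \<gamma> \<subseteq> (\<Union>p\<in>separated (simple_indices T). supported {p})"
      using root_space_positive_root[OF ab(2-4)] ab(1) by auto
  next
    fix p :: "'m \<times> 'm" assume p: "p \<in> separated (simple_indices T)"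
    obtain a b where ab: "p = (a, b)" by (cases p)
    have lt: "pos a < pos b"
      using p ab by (auto simp: separated_def)
    have "eps (pos a) - eps (pos b) \<in> nilradical_roots T"
      using p ab lt by (subst positive_root_in_nilradical_roots[OF T]) (use pos_bounds[of a] pos_bounds[of b] in \<open>auto simp: separated_def\<close>)
    moreover have "root_space (eps (pos a) - eps (pos b)) = supported {p}"
      using root_space_positive_root[OF pos_bounds(1) lt pos_bounds(2)] ab by simp
    ultimately show "supported {p} \<subseteq> (\<Union>\<gamma>\<in>nilradical_roots T. root_space \<gamma>)"
      by blast
  qed
  moreover have "gl.span (\<Union>p\<in>S. supported {p}) = supported S" for S :: "('m \<times> 'm) set"
  proof
    show "gl.span (\<Union>p\<in>S. supported {p}) \<subseteq> supported S"
      by (rule gl.span_minimal[OF _ subspace_supported]) (auto simp: supported_def)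
    have "(\<lambda>(a, b). elem a b) ` S \<subseteq> (\<Union>p\<in>S. supported {p})"
      by force
    then show "supported S \<subseteq> gl.span (\<Union>p\<in>S. supported {p})"
      using gl.span_mono unfolding span_elem[symmetric] by blast
  qed
  ultimately show ?thesis
    by (simp add: nilradical_def)
qed

lemma north_east_square_eq_supported:
  "north_east_square k = supported {(a, b :: 'm::{finite,linorder}). pos a \<le> k \<and> CARD('m) - k < pos b}"
proof safe
  fix A :: "'m cmat" assume A: "A \<in> north_east_square k"
  have "pos a \<le> k \<and> CARD('m) - k < pos b" if "A $ a $ b \<noteq> 0" for a b
  proof -
    have "pos a \<in> {1..CARD('m)}" "pos b \<in> {1..CARD('m)}"
      by (simp_all add: pos_bounds[simplified])
    moreover have "A $ idx (pos a) $ idx (pos b) \<noteq> 0"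
      using that by simp
    ultimately show ?thesis
      using A unfolding north_east_square_def by blast
  qed
  then show "A \<in> supported {(a, b). pos a \<le> k \<and> CARD('m) - k < pos b}"
    by (auto simp: supported_def)
next
  fix A :: "'m cmat" assume "A \<in> supported {(a, b). pos a \<le> k \<and> CARD('m) - k < pos b}"
  then have A: "pos (idx i :: 'm) \<le> k \<and> CARD('m) - k < pos (idx j :: 'm)"
    if "A $ idx i $ idx j \<noteq> 0" for i j
    using that by (auto simp: supported_def)
  have "i \<le> k \<and> CARD('m) - k < j"
    if "i \<in> {1..CARD('m)}" "j \<in> {1..CARD('m)}" "A $ idx i $ idx j \<noteq> 0" for i j
    using A[OF that(3)] that by simp
  then show "A \<in> north_east_square k"
    unfolding north_east_square_def by blast
qed

subsection \<open>The antidiagonal functional\<close>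

text \<open>Reflection of the indices, chosen so that the position of the \<open>i\<close>-th
  cascade root is \<open>(a, opposite a)\<close> with \<open>a = idx i\<close>.\<close>

definition opposite :: "'m::{finite,linorder} \<Rightarrow> 'm" where
  "opposite a = idx (CARD('m) + 1 - pos a)"

lemma pos_opposite: "pos (opposite a) = CARD('m) + 1 - pos (a :: 'm::{finite,linorder})"
  using pos_bounds[of a] by (simp add: opposite_def)

lemma opposite_opposite [simp]: "opposite (opposite a) = (a :: 'm::{finite,linorder})"
proof -
  have "pos (opposite (opposite a)) = pos a"
    using pos_bounds[of a] by (simp add: pos_opposite)
  then show ?thesis
    by simp
qed

lemma opposite_eq_iff: "opposite a = b \<longleftrightarrow> a = opposite b"
  by (metis opposite_opposite)

text \<open>For \<open>k\<close> at most half the matrix size, the entries summed are the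
  coordinates along the first \<open>k\<close> cascade roots.\<close>

definition antidiagonal_sum :: "nat \<Rightarrow> 'm::{finite,linorder} cmat \<Rightarrow> complex" where
  "antidiagonal_sum k X = (\<Sum>a | pos a \<le> k. X $ a $ opposite a)"

lemma antidiagonal_sum_add: "antidiagonal_sum k (X + Y) = antidiagonal_sum k X + antidiagonal_sum k Y"
  and antidiagonal_sum_scale: "antidiagonal_sum k (mat_scale c X) = c * antidiagonal_sum k X"
  by (simp_all add: antidiagonal_sum_def sum.distrib sum_distrib_left)

lemma mult_elem_nth: "(X ** elem p q) $ i $ j = (if j = q then X $ i $ p else 0)"
proof -
  have "(X ** elem p q) $ i $ j = (\<Sum>r\<in>UNIV. if r = p then (if j = q then X $ i $ p else 0) else 0)"
    unfolding matrix_matrix_mult_def vec_lambda_beta by (intro sum.cong refl) simp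
  then show ?thesis
    by simp
qed

lemma elem_mult_nth: "(elem p q ** X) $ i $ j = (if i = p then X $ q $ j else 0)"
proof -
  have "(elem p q ** X) $ i $ j = (\<Sum>r\<in>UNIV. if r = q then (if i = p then X $ q $ j else 0) else 0)"
    unfolding matrix_matrix_mult_def vec_lambda_beta by (intro sum.cong refl) simp
  then show ?thesis
    by simp
qed

lemma elem_mult_elem: "elem a b ** elem c d = (if b = c then elem a d else 0)"
  by (simp add: vec_eq_iff mult_elem_nth)

text \<open>Testing against a matrix unit leaves at most two entries of \<open>X\<close>, and these
  two positions are exchanged by the half-turn of the matrix.\<close>

lemma antidiagonal_sum_commutator_elem:
  "antidiagonal_sum k (commutator X (elem p q))
    = (if pos (opposite q) \<le> k then X $ opposite q $ p else 0)
    - (if pos p \<le> k then X $ q $ opposite p else 0)"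
proof -
  have "antidiagonal_sum k (commutator X (elem p q))
      = (\<Sum>a | pos a \<le> k. if a = opposite q then X $ opposite q $ p else 0)
      - (\<Sum>a | pos a \<le> k. if a = p then X $ q $ opposite p else 0)"
    unfolding antidiagonal_sum_def sum_subtractf[symmetric]
    by (intro sum.cong refl)
      (simp add: commutator_def mult_elem_nth elem_mult_nth opposite_eq_iff)
  then show ?thesis
    by simp
qed

subsection \<open>Abelian ideals of block matrices\<close>

lemma separated_trans: "(a, c) \<in> separated J \<Longrightarrow> (c, b) \<in> separated J \<Longrightarrow> (a, b) \<in> separated J"
proof -
  assume "(a, c) \<in> separated J" "(c, b) \<in> separated J"
  then obtain i j where "i \<in> J" "pos a \<le> i" "i < pos c" "pos c \<le> j" "j < pos b"
    by (auto simp: separated_def)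
  then have "i \<in> J" "pos a \<le> i" "i < pos b"
    by linarith+
  then show ?thesis
    by (auto simp: separated_def)
qed

lemma matrix_mult_supported:
  assumes X: "X \<in> supported S" and Y: "Y \<in> supported S'"
  shows "X ** Y \<in> supported {(a, b). \<exists>c. (a, c) \<in> S \<and> (c, b) \<in> S'}"
proof -
  have "(X ** Y) $ a $ b = 0" if "\<nexists>c. (a, c) \<in> S \<and> (c, b) \<in> S'" for a b
  proof -
    have "X $ a $ c * Y $ c $ b = 0" for c
      using that supported_zero[OF X, of a c] supported_zero[OF Y, of c b] by auto
    then show ?thesis
      unfolding matrix_matrix_mult_def vec_lambda_beta by (intro sum.neutral ballI)
  qed
  then show ?thesis
    unfolding supported_def by blast
qed

lemma commutator_in_supported_separated:
  assumes "X \<in> supported (separated J)" "Y \<in> supported (separated J)"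
  shows "commutator X Y \<in> supported (separated J)"
proof -
  have "{(a, b). \<exists>c. (a, c) \<in> separated J \<and> (c, b) \<in> separated J} \<subseteq> separated J"
    by (auto intro: separated_trans)
  then have "X ** Y \<in> supported (separated J)" "Y ** X \<in> supported (separated J)"
    using matrix_mult_supported[OF assms] matrix_mult_supported[OF assms(2,1)]
      supported_mono by blast+
  then show ?thesis
    unfolding commutator_def by (rule gl.subspace_diff[OF subspace_supported])
qed

text \<open>All products vanish, since a middle index would have to lie on both sides of the
  cut.\<close>

lemma supported_separated_singleton_abelian:
  fixes X Y :: "'m::{finite,linorder} cmat"
  assumes "X \<in> supported (separated {c})" "Y \<in> supported (separated {c})"
  shows "commutator X Y = 0"
proof -
  have "{(a :: 'm, b :: 'm). \<exists>d. (a, d) \<in> separated {c} \<and> (d, b) \<in> separated {c}} = {}"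
    by (auto simp: separated_def)
  then have "X ** Y \<in> supported {}" "Y ** X \<in> supported {}"
    using matrix_mult_supported[OF assms] matrix_mult_supported[OF assms(2,1)] by (simp_all only:)
  then have "X ** Y = 0" "Y ** X = 0"
    by (simp_all add: supported_def vec_eq_iff)
  then show ?thesis
    by (simp add: commutator_def)
qed

lemma antidiagonal_sum_in_dual_space:
  "restrict (antidiagonal_sum k) (supported S) \<in> gl.dual_space (supported S)"
  by (simp add: gl.dual_space_def antidiagonal_sum_add antidiagonal_sum_scale
      gl.subspace_add[OF subspace_supported] gl.subspace_scale[OF subspace_supported])

text \<open>Orthogonality equates entries of \<open>X\<close> exchanged by the half-turn, as far as
  the first \<open>k\<close> antidiagonal positions reach. The half-turn carries the upper triangle
  to the lower one, where \<open>X\<close> vanishes; the gap in \<open>J\<close> ensures that every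
  entry outside the block is within reach.\<close>

lemma antidiagonal_orthogonal_subset:
  fixes J :: "nat set"
  assumes k: "2 * k \<le> CARD('m)" and gap: "J \<inter> {k<..<CARD('m) - k} = {}"
    and c: "c \<in> {k, CARD('m) - k}"
    and X: "X \<in> supported (separated J :: ('m::{finite,linorder} \<times> 'm) set)"
    and orth: "\<And>Y. Y \<in> supported (separated {c}) \<Longrightarrow> antidiagonal_sum k (commutator X Y) = 0"
  shows "X \<in> supported (separated {c})"
proof -
  have eq: "(if pos (opposite q) \<le> k then X $ opposite q $ p else 0)
      = (if pos p \<le> k then X $ q $ opposite p else 0)"
    if "pos p \<le> c" "c < pos q" for p q
    using orth[of "elem p q"] that by (simp add: antidiagonal_sum_commutator_elem separated_def)
  have "(a, b) \<in> separated {c}" if nz: "X $ a $ b \<noteq> 0" for a b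
  proof (rule ccontr)
    assume "(a, b) \<notin> separated {c}"
    then have side: "pos b \<le> c \<or> c < pos a"
      by (auto simp: separated_def)
    obtain j where j: "j \<in> J" "pos a \<le> j" "j < pos b"
      using X nz by (auto simp: supported_def separated_def)
    have jk: "j \<le> k \<or> CARD('m) - k \<le> j"
      using gap j(1) by (metis disjoint_iff greaterThanLessThan_iff not_le)
    note bounds = pos_bounds[of a] pos_bounds[of b]
    have "pos (opposite b) \<le> pos (opposite a)"
      using j bounds by (simp add: pos_opposite)
    then have "(opposite a, opposite b) \<notin> separated J"
      by (auto simp: separated_def)
    then have zero: "X $ opposite a $ opposite b = 0"
      by (rule supported_zero[OF X])
    from side show False
    proof
      assume b: "pos b \<le> c"
      \<comment> \<open>Here \<open>j < c\<close>, and \<open>c\<close> is at most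
        \<open>CARD('m) - k\<close>, so \<open>j\<close> lies before the gap.\<close>
      then have "pos a \<le> k"
        using c j jk k by auto
      moreover from this have "c < pos (opposite a)"
        using c k bounds by (auto simp: pos_opposite)
      ultimately show False
        using eq[OF b, of "opposite a"] zero nz by (simp split: if_splits)
    next
      assume a: "c < pos a"
      \<comment> \<open>Here \<open>j\<close> exceeds \<open>c\<close>, hence lies beyond the gap,
        and \<open>b\<close> is among the last \<open>k\<close> columns.\<close>
      then have "pos (opposite b) \<le> k"
        using c j jk k bounds by (auto simp: pos_opposite)
      moreover from this have "pos (opposite b) \<le> c"
        using c k by auto
      ultimately show False
        using eq[OF _ a, of "opposite b"] zero nz by (simp split: if_splits)
    qed
  qed
  then show ?thesis
    by (simp add: supported_def)
qed

text \<open>The functional does not depend on \<open>c\<close>. When both admissible cuts belong to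
  \<open>J\<close>, the semiradical is thus confined to both blocks at once.\<close>

lemma
  fixes J :: "nat set"
  assumes k: "2 * k \<le> CARD('m)" and gap: "J \<inter> {k<..<CARD('m) - k} = {}"
    and c: "c \<in> J" "c \<in> {k, CARD('m) - k}"
  defines "q \<equiv> supported (separated J :: ('m::{finite,linorder} \<times> 'm) set)"
  shows antidiagonal_sum_regular: "restrict (antidiagonal_sum k) q \<in> gl.regular_functionals q"
    and frobenius_semiradical_subset: "gl.frobenius_semiradical q \<subseteq> supported (separated {c})"
proof -
  let ?\<xi> = "restrict (antidiagonal_sum k) q" and ?a = "supported (separated {c}) :: 'm cmat set"
  have q: "gl.subspace q" and closed: "\<And>X Y. X \<in> q \<Longrightarrow> Y \<in> q \<Longrightarrow> commutator X Y \<in> q"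
    unfolding q_def by (rule subspace_supported, rule commutator_in_supported_separated)
  have sub: "?a \<subseteq> q"
    unfolding q_def using c(1) by (intro supported_mono) (auto simp: separated_def)
  have orth: "{X \<in> q. \<forall>Y\<in>?a. ?\<xi> (commutator X Y) = 0} \<subseteq> ?a"
  proof safe
    fix X assume X: "X \<in> q" "\<forall>Y\<in>?a. ?\<xi> (commutator X Y) = 0"
    have "antidiagonal_sum k (commutator X Y) = 0" if "Y \<in> ?a" for Y
      using X that closed[OF X(1)] sub by (metis restrict_apply' subsetD)
    then show "X \<in> ?a"
      using antidiagonal_orthogonal_subset[OF k gap c(2)] X(1) unfolding q_def by blast
  qed
  have dual: "?\<xi> \<in> gl.dual_space q"
    unfolding q_def by (rule antidiagonal_sum_in_dual_space)
  show "?\<xi> \<in> gl.regular_functionals q"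
    by (rule gl.commutative_polarisation(1)[OF q closed subspace_supported sub
          supported_separated_singleton_abelian dual orth])
  show "gl.frobenius_semiradical q \<subseteq> ?a"
    by (rule gl.commutative_polarisation(2)[OF q closed subspace_supported sub
          supported_separated_singleton_abelian dual orth])
qed

subsection \<open>Conjugation by elementary unipotent matrices\<close>

text \<open>Multiplying by such a matrix unit moves a row weakly upwards or a column weakly to the
  right, and neither leaves the block upper triangle.\<close>

lemma elem_mult_supported_separated:
  assumes X: "X \<in> supported (separated J)" and le: "pos a \<le> pos b"
  shows "elem a b ** X \<in> supported (separated J)" and "X ** elem a b \<in> supported (separated J)"
proof -
  have "(i, b) \<in> separated J" if "(i, a) \<in> separated J" for i
    using that le by (auto simp: separated_def)
  moreover have "(a, j) \<in> separated J" if "(b, j) \<in> separated J" for j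
    using that le order_trans by (fastforce simp: separated_def)
  ultimately show "elem a b ** X \<in> supported (separated J)" "X ** elem a b \<in> supported (separated J)"
    using X by (auto simp: supported_def elem_mult_nth mult_elem_nth split: if_splits)
qed

text \<open>The square of \<open>elem a b\<close> is zero for distinct \<open>a\<close> and
  \<open>b\<close>, so the two factors are mutually inverse, and conjugation by them is an
  automorphism preserving the subalgebra.\<close>

lemma frobenius_semiradical_conjugate:
  assumes lt: "pos a < pos b"
    and X: "X \<in> gl.frobenius_semiradical (supported (separated J))"
  shows "(mat 1 + elem a b) ** X ** (mat 1 - elem a b) \<in> gl.frobenius_semiradical (supported (separated J))"
proof -
  let ?P = "mat 1 + elem a b" and ?Q = "mat 1 - elem a b" and ?q = "supported (separated J)"
  have ne: "b \<noteq> a"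
    using lt by auto
  have PQ: "?P ** ?Q = mat 1" and QP: "?Q ** ?P = mat 1"
    using ne by (simp_all add: matrix_mult_add_left matrix_mult_diff_left matrix_add_ldistrib
        matrix_mult_diff_right elem_mult_elem)
  have lin: "Vector_Spaces.linear mat_scale mat_scale (\<lambda>X. A ** X ** B)" for A B :: "'a cmat"
    by unfold_locales
      (simp_all add: matrix_add_ldistrib matrix_mult_add_left mat_scale_mult_left mat_scale_mult_right)
  have left: "?P ** Y \<in> ?q" "?Q ** Y \<in> ?q" and right: "Y ** ?P \<in> ?q" "Y ** ?Q \<in> ?q" if "Y \<in> ?q" for Y
    using that elem_mult_supported_separated[OF that less_imp_le[OF lt]]
    by (simp_all add: matrix_mult_add_left matrix_mult_diff_left matrix_add_ldistrib
        matrix_mult_diff_right gl.subspace_add gl.subspace_diff subspace_supported)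
  have cancel: "A ** (B ** Y ** A) ** B = Y" if "A ** B = mat 1" for A B Y :: "'a cmat"
  proof -
    have "A ** (B ** Y ** A) ** B = (A ** B) ** Y ** (A ** B)"
      by (simp only: matrix_mul_assoc)
    then show ?thesis
      using that by simp
  qed
  have hom: "?Q ** commutator Y Z ** ?P = commutator (?Q ** Y ** ?P) (?Q ** Z ** ?P)" for Y Z
  proof -
    have "?Q ** Y ** ?P ** (?Q ** Z ** ?P) = ?Q ** Y ** (?P ** ?Q) ** Z ** ?P" for Y Z
      by (simp only: matrix_mul_assoc)
    then show ?thesis
      unfolding PQ by (simp add: commutator_def matrix_mult_diff_left matrix_mult_diff_right matrix_mul_assoc)
  qed
  show ?thesis
    by (rule gl.frobenius_semiradical_automorphism[OF subspace_supported
          commutator_in_supported_separated lin lin _ _ cancel[OF PQ] cancel[OF QP] hom X])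
      (simp_all add: left right)
qed

text \<open>Conjugating by \<open>mat 1 + elem a u\<close> climbs the column \<open>v\<close> from
  the south-west position; conjugating by \<open>mat 1 + elem v b\<close> then spreads each entry of
  that column along its row. Subtracting the old matrix unit isolates the new one up to
  sign.\<close>

lemma supported_corner_subset_frobenius_semiradical:
  fixes u v :: "'m::{finite,linorder}"
  assumes E: "elem u v \<in> gl.frobenius_semiradical (supported (separated J))" and uv: "pos u < pos v"
  shows "supported {(a, b). pos a \<le> pos u \<and> pos v \<le> pos (b :: 'm)}
    \<subseteq> gl.frobenius_semiradical (supported (separated J))"
proof -
  let ?F = "gl.frobenius_semiradical (supported (separated J))"
  have F: "gl.subspace ?F"
    unfolding gl.frobenius_semiradical_def by (rule gl.subspace_span)
  have row: "elem a v \<in> ?F" if le: "pos a \<le> pos u" for a :: 'm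
  proof (cases "a = u")
    case False
    then have lt: "pos a < pos u"
      using le by (simp add: order_less_le)
    have ne: "v \<noteq> a" "u \<noteq> v"
      using lt uv by auto
    have "(mat 1 + elem a u) ** elem u v ** (mat 1 - elem a u) = elem u v + elem a v"
      using ne by (simp add: matrix_mult_add_left matrix_mult_diff_right elem_mult_elem)
    then have "elem u v + elem a v \<in> ?F"
      using frobenius_semiradical_conjugate[OF lt E] by simp
    then show ?thesis
      using gl.subspace_diff[OF F _ E] by fastforce
  qed (simp add: E)
  have "elem a b \<in> ?F" if le: "pos a \<le> pos u" "pos v \<le> pos b" for a b :: 'm
  proof (cases "b = v")
    case False
    then have lt: "pos v < pos b"
      using le by (simp add: order_less_le)
    have ne: "b \<noteq> a"
      using lt le uv by auto
    have "(mat 1 + elem v b) ** elem a v ** (mat 1 - elem v b) = elem a v - elem a b"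
      using ne by (simp add: matrix_mult_add_left matrix_mult_diff_right elem_mult_elem)
    then have "elem a v - elem a b \<in> ?F"
      using frobenius_semiradical_conjugate[OF lt row[OF le(1)]] by simp
    then show ?thesis
      using gl.subspace_diff[OF F row[OF le(1)]] by fastforce
  qed (simp add: row le)
  then have "(\<lambda>(a, b). elem a b) ` {(a, b :: 'm). pos a \<le> pos u \<and> pos v \<le> pos b} \<subseteq> ?F"
    by auto
  from gl.span_minimal[OF this F] show ?thesis
    by (simp only: span_elem)
qed

text \<open>The functional of a commutator with \<open>elem u v\<close> sees only the entries at
  \<open>(opposite v, u)\<close> and \<open>(v, opposite u)\<close>; the hypotheses put each one
  that counts outside the support.\<close>

lemma elem_in_antidiagonal_stabiliser:
  assumes sep: "(u, v) \<in> separated J"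
    and uv: "pos (opposite v) \<le> k \<Longrightarrow> (opposite v, u) \<notin> separated J"
      "pos u \<le> k \<Longrightarrow> (v, opposite u) \<notin> separated J"
  defines "q \<equiv> supported (separated J)"
  shows "elem u v \<in> gl.stabiliser q (restrict (antidiagonal_sum k) q)"
proof -
  have E: "elem u v \<in> q"
    using sep by (simp add: q_def)
  have "restrict (antidiagonal_sum k) q (commutator (elem u v) Y) = 0" if Y: "Y \<in> q" for Y
  proof -
    have "antidiagonal_sum k (commutator Y (elem u v)) = 0"
      using supported_zero[OF Y[unfolded q_def]] uv by (simp add: antidiagonal_sum_commutator_elem)
    moreover have "commutator (elem u v) Y = mat_scale (-1) (commutator Y (elem u v))"
      by (simp add: commutator_def vec_eq_iff)
    moreover have "commutator (elem u v) Y \<in> q"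
      using commutator_in_supported_separated E Y unfolding q_def by blast
    ultimately show ?thesis
      by (simp only: restrict_apply' antidiagonal_sum_scale mult_zero_right)
  qed
  then show ?thesis
    using E by (simp add: gl.stabiliser_def)
qed

text \<open>Common form of both cases. \<open>C\<close> collects the cuts in use,
  \<open>corner\<close> describes the intersection of their blocks by its south-west position, and
  \<open>stab\<close> is the arithmetic form of the condition that the matrix unit there stabilises
  the antidiagonal functional.\<close>

lemma frobenius_semiradical_eq_corner:
  fixes J :: "nat set"
  assumes k: "2 * k \<le> CARD('m)" and gap: "J \<inter> {k<..<CARD('m) - k} = {}"
    and C: "C \<subseteq> J \<inter> {k, CARD('m) - k}" "C \<noteq> {}"
    and uv: "1 \<le> u" "u < v" "v \<le> CARD('m)"
    and corner: "\<And>a b. 1 \<le> a \<Longrightarrow> b \<le> CARD('m) \<Longrightarrow> (\<forall>c\<in>C. a \<le> c \<and> c < b) \<longleftrightarrow> a \<le> u \<and> v \<le> b"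
    and stab: "\<And>j. j \<in> J \<Longrightarrow> CARD('m) + 1 - v \<le> k \<Longrightarrow> CARD('m) + 1 - v \<le> j \<Longrightarrow> u \<le> j"
      "\<And>j. j \<in> J \<Longrightarrow> u \<le> k \<Longrightarrow> v \<le> j \<Longrightarrow> CARD('m) + 1 - u \<le> j"
  defines "q \<equiv> supported (separated J :: ('m::{finite,linorder} \<times> 'm) set)"
  shows "gl.frobenius_semiradical q = supported {(a, b). pos a \<le> u \<and> v \<le> pos b}"
    and "gl.dim (gl.frobenius_semiradical q) = u * (CARD('m) + 1 - v)"
proof -
  have posuv [simp]: "pos (idx u :: 'm) = u" "pos (idx v :: 'm) = v"
    using uv by simp_all
  obtain c where c: "c \<in> C"
    using C(2) by blast
  have c_uv: "\<forall>c\<in>C. u \<le> c \<and> c < v"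
    using corner[of u v] uv by simp
  have reg: "restrict (antidiagonal_sum k) q \<in> gl.regular_functionals q"
    unfolding q_def using antidiagonal_sum_regular[OF k gap] c C(1) by blast
  have "elem (idx u) (idx v) \<in> gl.stabiliser q (restrict (antidiagonal_sum k) q)"
    unfolding q_def
  proof (rule elem_in_antidiagonal_stabiliser)
    show "(idx u, idx v :: 'm) \<in> separated J"
      using c c_uv C(1) by (auto simp: separated_def)
    show "(opposite (idx v :: 'm), idx u) \<notin> separated J" if "pos (opposite (idx v :: 'm)) \<le> k"
      using that stab(1) by (force simp: separated_def pos_opposite)
    show "(idx v, opposite (idx u :: 'm)) \<notin> separated J" if "pos (idx u :: 'm) \<le> k"
      using that stab(2) by (force simp: separated_def pos_opposite)
  qed
  then have E: "elem (idx u) (idx v) \<in> gl.frobenius_semiradical q"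
    unfolding gl.frobenius_semiradical_def using reg by (intro gl.span_base) blast
  show eq: "gl.frobenius_semiradical q = supported {(a, b). pos a \<le> u \<and> v \<le> pos b}"
  proof
    show "supported {(a, b). pos a \<le> u \<and> v \<le> pos b} \<subseteq> gl.frobenius_semiradical q"
      using supported_corner_subset_frobenius_semiradical[OF E[unfolded q_def]] uv
      by (simp add: q_def)
    have "X \<in> supported {(a, b). pos a \<le> u \<and> v \<le> pos b}"
      if X: "X \<in> gl.frobenius_semiradical q" for X
    proof -
      have "X \<in> supported (separated {c})" if "c \<in> C" for c
        using frobenius_semiradical_subset[OF k gap, of c] C(1) that X unfolding q_def by blast
      then have "pos a \<le> c \<and> c < pos b" if "X $ a $ b \<noteq> 0" "c \<in> C" for a b c
        using that by (force simp: supported_def separated_def)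
      then show ?thesis
        using corner[OF pos_bounds] unfolding supported_def by blast
    qed
    then show "gl.frobenius_semiradical q \<subseteq> supported {(a, b). pos a \<le> u \<and> v \<le> pos b}"
      by blast
  qed
  have "{i \<in> {1..CARD('m)}. i \<le> u} = {1..u}" "{i \<in> {1..CARD('m)}. v \<le> i} = {v..CARD('m)}"
    using uv by auto
  then have "card {a :: 'm. pos a \<le> u} = u" "card {b :: 'm. v \<le> pos b} = CARD('m) + 1 - v"
    using card_pos_Collect[where ?'m = 'm, of "\<lambda>i. i \<le> u"]
      card_pos_Collect[where ?'m = 'm, of "\<lambda>i. v \<le> i"] uv by simp_all
  moreover have "{(a :: 'm, b :: 'm). pos a \<le> u \<and> v \<le> pos b} = {a. pos a \<le> u} \<times> {b. v \<le> pos b}"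
    by auto
  ultimately show "gl.dim (gl.frobenius_semiradical q) = u * (CARD('m) + 1 - v)"
    unfolding eq dim_supported by (simp add: card_cartesian_product)
qed

subsection \<open>Nilradicals of \<open>sl\<close>\<close>

lemma simple_indices_singleton:
  assumes "j \<in> {1..<CARD('m)}"
  shows "simple_indices {simple_root j :: 'm::{finite,linorder} weight} = {j}"
proof -
  have "i = j" if "i \<in> {1..<CARD('m)}" "simple_root i = (simple_root j :: 'm weight)" for i
    using inj_onD[OF inj_on_simple_root that(2,1) assms] .
  then show ?thesis
    using assms unfolding simple_indices_def by blast
qed

section \<open>Cuts prescribed by the Kostant cascade\<close>

lemma inj_on_cascade_root:
  "inj_on (cascade_root :: nat \<Rightarrow> 'm::{finite,linorder} weight) {1..CARD('m) div 2}"
proof (rule inj_onI)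
  fix i j assume ij: "i \<in> {1..CARD('m) div 2}" "j \<in> {1..CARD('m) div 2}"
    and eq: "cascade_root i = (cascade_root j :: 'm weight)"
  \<comment> \<open>The negative term of a cascade root sits in the second half, beyond
    \<open>l\<close>.\<close>
  have ps: "partial_sum l (cascade_root i :: 'm weight) = (if i \<le> l then 1 else 0)"
    if "i \<in> {1..CARD('m) div 2}" "l \<le> CARD('m) div 2" for i l
    using that partial_sum_eps[where ?'m = 'm, of i l]
      partial_sum_eps[where ?'m = 'm, of "CARD('m) + 1 - i" l]
    by (auto simp: cascade_root_def linear_diff[OF linear_partial_sum])
  have "j \<le> i" "i \<le> j"
    using ps[OF ij(1), of i] ps[OF ij(2), of i] ps[OF ij(1), of j] ps[OF ij(2), of j] ij eq
    by (simp_all split: if_splits)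
  then show "i = j"
    by simp
qed

lemma cascade_root_in_nilradical_roots:
  fixes T :: "'m::{finite,linorder} weight set"
  assumes "T \<subseteq> simple_roots" "i \<in> {1..CARD('m) div 2}"
  shows "cascade_root i \<in> nilradical_roots T \<longleftrightarrow> simple_indices T \<inter> {i..CARD('m) - i} \<noteq> {}"
proof -
  have "cascade_root i \<in> nilradical_roots T
      \<longleftrightarrow> (\<exists>j\<in>simple_indices T. i \<le> j \<and> j < CARD('m) + 1 - i)"
    unfolding cascade_root_def
    by (rule positive_root_in_nilradical_roots[OF assms(1)]) (use assms(2) in auto)
  moreover have "j < CARD('m) + 1 - i \<longleftrightarrow> j \<le> CARD('m) - i" for j
    using assms(2) by auto
  ultimately show ?thesis
    by auto
qed

text \<open>A cut strictly inside the gap would make the next cascade root a root of the nilradical,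
  and injectivity keeps that root from being one of the first \<open>k\<close>. The root with index
  \<open>k\<close> itself forces a cut in the closed interval, hence at an endpoint.\<close>

lemma simple_indices_of_cascade:
  fixes T :: "'m::{finite,linorder} weight set"
  assumes T: "T \<subseteq> simple_roots" and k: "1 \<le> k" "k \<le> CARD('m) div 2"
    and cascade: "kostant_cascade \<inter> nilradical_roots T = cascade_root ` {1..k}"
  shows "simple_indices T \<inter> {k<..<CARD('m) - k} = {}"
    and "simple_indices T \<inter> {k, CARD('m) - k} \<noteq> {}"
proof -
  show gap: "simple_indices T \<inter> {k<..<CARD('m) - k} = {}"
  proof (rule ccontr)
    assume *: "simple_indices T \<inter> {k<..<CARD('m) - k} \<noteq> {}"
    \<comment> \<open>A point strictly between \<open>k\<close> and \<open>CARD('m) - k\<close>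
      leaves room for one more cascade root.\<close>
    then have k': "Suc k \<in> {1..CARD('m) div 2}"
      by auto
    have "{k<..<CARD('m) - k} = {Suc k..CARD('m) - Suc k}"
      by auto
    then have "cascade_root (Suc k) \<in> kostant_cascade \<inter> nilradical_roots T"
      using * k' cascade_root_in_nilradical_roots[OF T k'] by (simp add: kostant_cascade_def)
    then obtain i where i: "i \<in> {1..k}" "cascade_root (Suc k) = (cascade_root i :: 'm weight)"
      unfolding cascade by blast
    have "i \<in> {1..CARD('m) div 2}"
      using i k by simp
    then have "Suc k = i"
      using inj_onD[OF inj_on_cascade_root i(2) k'] by blast
    then show False
      using i by simp
  qed
  have "cascade_root k \<in> nilradical_roots T"
    using cascade k by auto
  then have "simple_indices T \<inter> {k..CARD('m) - k} \<noteq> {}"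
    using cascade_root_in_nilradical_roots[OF T, of k] k by simp
  then obtain j where j: "j \<in> simple_indices T" "j \<in> {k..CARD('m) - k}"
    by blast
  moreover have "j \<notin> {k<..<CARD('m) - k}"
    using gap j(1) by blast
  ultimately show "simple_indices T \<inter> {k, CARD('m) - k} \<noteq> {}"
    by auto
qed

theorem mainTheorem11:
  fixes n k :: nat and T :: "'m::{finite,linorder} weight set"
  assumes "CARD('m) = n + 1"
    and "T \<subseteq> simple_roots" and "T \<noteq> {}"
    and "1 \<le> k" and "k \<le> (n + 1) div 2"
    and "kostant_cascade \<inter> nilradical_roots T = cascade_root ` {1..k}"
  shows "T \<inter> {simple_root k, simple_root (n + 1 - k)} \<noteq> {} \<and>
    (simple_root k \<in> T \<and> simple_root (n + 1 - k) \<in> T \<longrightarrow>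
      gl.frobenius_semiradical (nilradical T)
        = nilradical {simple_root k} \<inter> nilradical {simple_root (n + 1 - k)} \<and>
      nilradical {simple_root k} \<inter> nilradical {simple_root (n + 1 - k)}
        = (north_east_square k :: 'm cmat set) \<and>
      gl.dim (gl.frobenius_semiradical (nilradical T)) = k\<^sup>2) \<and>
    (\<forall>\<alpha>. simple_root k \<noteq> (simple_root (n + 1 - k) :: 'm weight) \<and>
      T \<inter> {simple_root k, simple_root (n + 1 - k)} = {\<alpha>} \<longrightarrow>
      gl.frobenius_semiradical (nilradical T) = nilradical {\<alpha>} \<and>
      gl.dim (gl.frobenius_semiradical (nilradical T)) = k * (n + 1 - k))"
proof -
  note N = assms(1) and T = assms(2)
  let ?k' = "n + 1 - k" and ?J = "simple_indices T"
  have k: "1 \<le> k" "k \<le> CARD('m) div 2" and k2: "2 * k \<le> CARD('m)"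
    using assms(4,5) N by auto
  have kk': "k \<in> {1..<CARD('m)}" "?k' \<in> {1..<CARD('m)}"
    using k N by auto
  have cascade: "?J \<inter> {k<..<CARD('m) - k} = {}" "?J \<inter> {k, CARD('m) - k} \<noteq> {}"
    using simple_indices_of_cascade[OF T k assms(6)] by auto
  have mem: "j \<in> ?J \<longleftrightarrow> simple_root j \<in> T" if "j \<in> {1..<CARD('m)}" for j
    using that by (simp add: simple_indices_def)
  have nil: "nilradical {simple_root j :: 'm weight} = supported (separated {j})"
    if "j \<in> {1..<CARD('m)}" for j
    using that by (subst nilradical_eq_supported) (auto simp: simple_indices_singleton simple_roots_def)
  note frob = frobenius_semiradical_eq_corner[OF k2 cascade(1), folded nilradical_eq_supported[OF T]]
  have square: "nilradical {simple_root k} \<inter> nilradical {simple_root ?k'}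
      = supported {(a, b :: 'm). pos a \<le> k \<and> ?k' + 1 \<le> pos b}"
    unfolding nil[OF kk'(1)] nil[OF kk'(2)] supported_Int
    using k N by (intro arg_cong[of _ _ supported]) (auto simp: separated_def)
  have "T \<inter> {simple_root k, simple_root ?k'} \<noteq> {}"
    using cascade(2) mem[OF kk'(1)] mem[OF kk'(2)] N by auto
  moreover have "gl.frobenius_semiradical (nilradical T)
        = nilradical {simple_root k} \<inter> nilradical {simple_root ?k'} \<and>
      nilradical {simple_root k} \<inter> nilradical {simple_root ?k'}
        = (north_east_square k :: 'm cmat set) \<and>
      gl.dim (gl.frobenius_semiradical (nilradical T)) = k\<^sup>2"
    if "simple_root k \<in> T" "simple_root ?k' \<in> T"
  proof -
    have "{k, ?k'} \<subseteq> ?J \<inter> {k, CARD('m) - k}"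
      using that mem[OF kk'(1)] mem[OF kk'(2)] N by auto
    \<comment> \<open>The two blocks meet in rows up to \<open>k\<close> and columns beyond
      \<open>?k'\<close>; their south-west position is \<open>(k, ?k' + 1)\<close>.\<close>
    note F = frob[OF this, of k "?k' + 1"]
    have "gl.frobenius_semiradical (nilradical T) = supported {(a, b :: 'm). pos a \<le> k \<and> ?k' + 1 \<le> pos b}"
      by (rule F(1)) (use k N in auto)
    moreover have "gl.dim (gl.frobenius_semiradical (nilradical T)) = k * (CARD('m) + 1 - (?k' + 1))"
      by (rule F(2)) (use k N in auto)
    moreover have "CARD('m) + 1 - (?k' + 1) = k"
      using k N by auto
    moreover have "north_east_square k = supported {(a, b :: 'm). pos a \<le> k \<and> ?k' + 1 \<le> pos b}"
      unfolding north_east_square_eq_supported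
      using N by (intro arg_cong[of _ _ supported]) auto
    ultimately show ?thesis
      unfolding square by (simp only: power2_eq_square simp_thms)
  qed
  moreover have "gl.frobenius_semiradical (nilradical T) = nilradical {\<alpha>} \<and>
      gl.dim (gl.frobenius_semiradical (nilradical T)) = k * ?k'"
    if ne: "simple_root k \<noteq> (simple_root ?k' :: 'm weight)"
      and \<alpha>: "T \<inter> {simple_root k, simple_root ?k'} = {\<alpha>}" for \<alpha>
  proof -
    \<comment> \<open>Distinctness of the two simple roots excludes the middle case, where
      \<open>k\<close> is exactly half the matrix size.\<close>
    have lt: "k < ?k'"
      using ne k N by (cases "k = ?k'") auto
    consider "\<alpha> = simple_root k" | "\<alpha> = simple_root ?k'"
      using \<alpha> by blast
    then show ?thesis
    proof cases
      case 1
      then have J: "k \<in> ?J" "?k' \<notin> ?J"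
        using \<alpha> ne mem[OF kk'(1)] mem[OF kk'(2)] by auto
      \<comment> \<open>The missing cut at \<open>?k'\<close> widens the gap by one; this is the
        second stabiliser condition at the south-west position \<open>(k, k + 1)\<close>, and the
        first is vacuous there because \<open>k < ?k'\<close>.\<close>
      have gap: "j \<le> k \<or> ?k' < j" if "j \<in> ?J" for j
        using that J(2) cascade(1) N by (cases "j = ?k'") (auto simp: disjoint_iff)
      have C: "{k} \<subseteq> ?J \<inter> {k, CARD('m) - k}"
        using J by simp
      have "gl.frobenius_semiradical (nilradical T) = supported {(a, b :: 'm). pos a \<le> k \<and> k + 1 \<le> pos b}"
        by (rule frob(1)[OF C]) (use k lt N in \<open>auto dest!: gap\<close>)
      moreover have "gl.dim (gl.frobenius_semiradical (nilradical T)) = k * (CARD('m) + 1 - (k + 1))"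
        by (rule frob(2)[OF C]) (use k lt N in \<open>auto dest!: gap\<close>)
      moreover have "{(a, b :: 'm). pos a \<le> k \<and> k + 1 \<le> pos b} = separated {k}"
        by (auto simp: separated_def)
      ultimately show ?thesis
        using N 1 nil[OF kk'(1)] by simp
    next
      case 2
      then have J: "?k' \<in> ?J" "k \<notin> ?J"
        using \<alpha> ne mem[OF kk'(1)] mem[OF kk'(2)] by auto
      \<comment> \<open>Mirror image: the missing cut at \<open>k\<close> gives the first stabiliser
        condition at \<open>(?k', ?k' + 1)\<close>, and the second is vacuous.\<close>
      have gap: "j < k \<or> ?k' \<le> j" if "j \<in> ?J" for j
        using that J(2) cascade(1) N by (cases "j = k") (auto simp: disjoint_iff)
      have C: "{?k'} \<subseteq> ?J \<inter> {k, CARD('m) - k}"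
        using J N by simp
      have "gl.frobenius_semiradical (nilradical T) = supported {(a, b :: 'm). pos a \<le> ?k' \<and> ?k' + 1 \<le> pos b}"
        by (rule frob(1)[OF C]) (use k lt N in \<open>auto dest!: gap\<close>)
      moreover have "gl.dim (gl.frobenius_semiradical (nilradical T)) = ?k' * (CARD('m) + 1 - (?k' + 1))"
        by (rule frob(2)[OF C]) (use k lt N in \<open>auto dest!: gap\<close>)
      moreover have "{(a, b :: 'm). pos a \<le> ?k' \<and> ?k' + 1 \<le> pos b} = separated {?k'}"
        by (auto simp: separated_def)
      moreover have "CARD('m) + 1 - (?k' + 1) = k"
        using k N by auto
      ultimately show ?thesis
        using 2 nil[OF kk'(2)] by simp
    qed
  qed
  ultimately show ?thesis
    by blast
qed

end
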